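(* Let $z=(x,y)\in F$. Then the Bouligand tangent cone of $F$ at $z$ is $$T^B_F(z)=\{d=(d_1,d_2)\in\mathbb{R}^m\times\mathbb{R}^n:\ \|d_1\|_0\le s-1,\ \|d_2\|_0\le t;\ z+\mu d\in F\ \forall \mu\in\mathbb{R};\ d_j=0\ \forall j\le\gamma_x\}$$ $$=\bigcup_{\Lambda}\mathrm{span}\{e_i:\ i\in\Lambda\},$$ where in the first set $d_j$ for $j\le \gamma_x$ denotes the $j$-th entry of $d\in\mathbb{R}^{m+n}$, and the union is over all $\Lambda\subseteq I$ with $\Gamma\setminus\{\gamma_x\}\subseteq\Lambda$, $j\notin\Lambda$ for all $j\le\gamma_x$, $|\Lambda\cap I_1|\le s-1$ and $|\Lambda\cap I_2|\le t$. The Bouligand normal cone of $F$ at $z$ is $$N^B_F(z)=\begin{cases}\{d\in\mathbb{R}^{m+n}: d_i=0\ \forall i\in\Gamma\setminus\{\gamma_x\}\}&\text{if }|\Gamma_1|=s,\ |\Gamma_2|=t,\\ \{d\in\mathbb{R}^{m+n}: d_i=0\ \forall i\in(\Gamma_1\setminus\{\gamma_x\})\cup I_2\}&\text{if }|\Gamma_1|=s,\ |\Gamma_2|<t,\\ \{d\in\mathbb{R}^{m+n}: d_i=0\ \forall i\in\{\gamma_x+1,\dots,m\}\cup\Gamma_2\}&\text{if }|\Gamma_1|<s,\ |\Gamma_2|=t,\\ \{d\in\mathbb{R}^{m+n}: d_i=0\ \forall i\in I\text{ with }i>\gamma_x\}&\text{if }|\Gamma_1|<s,\ |\Gamma_2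|<t.\end{cases}$$
   Context: $m,n,s,t$ are positive integers with $s<m$, $t<n$. $I=\{1,\dots,m+n\}$, $I_1=\{1,\dots,m\}$, $I_2=\{m+1,\dots,m+n\}$. A vector $z=(x,y)\in\mathbb{R}^m\times\mathbb{R}^n$ is identified with a vector in $\mathbb{R}^{m+n}$; the coordinates of $y$ are indexed by $I_2$. $\Gamma=\{i\in I: z_i\ne0\}$, $\Gamma_1=\Gamma\cap I_1$ (support of $x$), $\Gamma_2=\Gamma\cap I_2$ (support of $y$). $\|\cdot\|_0$ is the number of nonzero entries. For $x\ne0$, $\gamma_x$ is the index of the first nonzero entry of $x$. $e_i$ is the $i$-th standard basis vector of $\mathbb{R}^{m+n}$. $F_1=\{x\in\mathbb{R}^m:\|x\|_0\le s,\ e_{\gamma_x}^\top x=1\}$ (nonzero vectors with at most $s$ nonzero entries and first nonzero entry equal to $1$), $F_2=\{y\in\mathbb{R}^n:\|y\|_0\le t\}$, $F=F_1\times F_2$. Bouligand cones: for a nonempty set $S\subseteq\mathbb{R}^p$ and $x\in S$, $T^B_S(x)$ is the set of all $d\in\mathbb{R}^p$ for which there exist $\{x^k\}\subset S$ with $x^k\to x$ and $\lambda_k\ge0$ such that $\lambda_k(x^k-x)\to d$; and $N^B_S(x)=\{d:\ \langle d,u\rangle\le0\ \forall u\in T^B_S(x)\}$. *)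

theory Defs
  imports "HOL-Analysis.Analysis"
begin

text \<open>
  The index sets \<open>{1..m}\<close> and \<open>{m+1..m+n}\<close> are rendered by finite linearly ordered types
  \<open>'m\<close> and \<open>'n\<close>, so \<open>m = CARD('m)\<close>, \<open>n = CARD('n)\<close>.  The index set \<open>I = {1..m+n}\<close> is the sum
  type \<open>'m + 'n\<close> with the ordinal-sum order: every \<open>Inl i\<close> precedes every \<open>Inr j\<close>.
\<close>

instantiation sum :: (linorder, linorder) linorder
begin

definition less_eq_sum :: "'a + 'b \<Rightarrow> 'a + 'b \<Rightarrow> bool" where
  "less_eq_sum p q = (case p of
     Inl i \<Rightarrow> (case q of Inl j \<Rightarrow> i \<le> j | Inr _ \<Rightarrow> True)
   | Inr i \<Rightarrow> (case q of Inl _ \<Rightarrow> False | Inr j \<Rightarrow> i \<le> j))"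

definition less_sum :: "'a + 'b \<Rightarrow> 'a + 'b \<Rightarrow> bool" where
  "less_sum p q \<longleftrightarrow> p \<le> q \<and> \<not> q \<le> p"

instance
  by standard (auto simp: less_eq_sum_def less_sum_def split: sum.splits)

end

definition I1 :: "('m + 'n) set" where
  "I1 = range Inl"

definition I2 :: "('m + 'n) set" where
  "I2 = range Inr"

text \<open>
  A vector of \<open>\<real>\<^sup>m\<^sup>+\<^sup>n\<close> is an element of the Euclidean space \<open>real ^ 'm \<times> real ^ 'n\<close>;
  \<open>coord\<close> and \<open>unit_vec\<close> give its coordinates and standard basis indexed by \<open>I\<close>.
\<close>

definition coord :: "(real ^ 'm) \<times> (real ^ 'n) \<Rightarrow> 'm + 'n \<Rightarrow> real" where
  "coord z i = (case i of Inl j \<Rightarrow> fst z $ j | Inr j \<Rightarrow> snd z $ j)"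

definition unit_vec :: "'m + 'n \<Rightarrow> (real ^ 'm) \<times> (real ^ 'n)" where
  "unit_vec i = (case i of Inl j \<Rightarrow> (axis j 1, 0) | Inr j \<Rightarrow> (0, axis j 1))"

definition supp :: "(real ^ 'm) \<times> (real ^ 'n) \<Rightarrow> ('m + 'n) set" where
  "supp z = {i. coord z i \<noteq> 0}"

definition l0 :: "real ^ 'k \<Rightarrow> nat" where
  "l0 x = card {i. x $ i \<noteq> 0}"

text \<open>Unspecified for \<open>x = 0\<close>.\<close>

definition first_nz :: "real ^ 'k::{finite,linorder} \<Rightarrow> 'k" where
  "first_nz x = Min {i. x $ i \<noteq> 0}"

definition F1 :: "nat \<Rightarrow> (real ^ 'm::{finite,linorder}) set" where
  "F1 s = {x. x \<noteq> 0 \<and> l0 x \<le> s \<and> axis (first_nz x) 1 \<bullet> x = 1}"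

definition F2 :: "nat \<Rightarrow> (real ^ 'n) set" where
  "F2 t = {y. l0 y \<le> t}"

definition F :: "nat \<Rightarrow> nat \<Rightarrow> ((real ^ 'm::{finite,linorder}) \<times> (real ^ 'n)) set" where
  "F s t = F1 s \<times> F2 t"

text \<open>Both cones are meant for \<open>x \<in> S\<close>.\<close>

definition bouligand_tangent :: "'a::real_normed_vector set \<Rightarrow> 'a \<Rightarrow> 'a set" where
  "bouligand_tangent S x =
     {d. \<exists>(X :: nat \<Rightarrow> 'a) (c :: nat \<Rightarrow> real).
           (\<forall>k. X k \<in> S) \<and> X \<longlonglongrightarrow> x \<and> (\<forall>k. c k \<ge> 0) \<and>
           (\<lambda>k. c k *\<^sub>R (X k - x)) \<longlonglongrightarrow> d}"

definition bouligand_normal :: "'a::real_inner set \<Rightarrow> 'a \<Rightarrow> 'a set" where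
  "bouligand_normal S x = {d. \<forall>u \<in> bouligand_tangent S x. d \<bullet> u \<le> 0}"

end

theory Submission
  imports Defs
begin

text \<open>
  Write \<open>\<gamma>\<close> for the position of the first nonzero entry of \<open>x\<close>.  Both cones are governed by one fact:
  a vector of \<open>F s t\<close> close to \<open>(x, y)\<close> is nonzero wherever \<open>(x, y)\<close> is nonzero, and its first
  component has its leading \<open>1\<close> at the same position \<open>\<gamma>\<close>.  Indeed a leading \<open>1\<close> before \<open>\<gamma>\<close> would be
  far from the entry \<open>0\<close> of \<open>x\<close>, and a leading entry after \<open>\<gamma>\<close> would mean an entry \<open>0\<close> at \<open>\<gamma>\<close>, where
  \<open>x\<close> has a \<open>1\<close>.

  If \<open>d\<close> is the limit of \<open>c\<^sub>k (X\<^sub>k - (x, y))\<close>, then \<open>d\<close> therefore vanishes up to \<open>\<gamma>\<close>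
  (there \<open>X\<^sub>k\<close> and \<open>(x, y)\<close> eventually agree), and \<open>X\<^sub>k\<close> is eventually nonzero on the supports of both
  \<open>(x, y)\<close> and \<open>d\<close>, so that the sparsity bounds apply to the union of the two supports
  (\<open>tangent_F1_necessary\<close>, \<open>tangent_F2_necessary\<close>).  Conversely, these bounds say that the whole line
  through \<open>(x, y)\<close> in direction \<open>d\<close> stays in \<open>F s t\<close>, which makes \<open>d\<close> tangent
  (\<open>bouligand_tangent_line\<close>).  Sorting the directions by a set \<open>\<Lambda>\<close> that contains their support,
  and the support of \<open>(x, y)\<close> except \<open>\<gamma>\<close>, turns the cone into a union of coordinate subspaces
  (\<open>tangent_iff_admissible\<close>).

  The normal cone of a union of coordinate subspaces is the orthogonal complement of all the basis
  vectors involved (\<open>normal_of_coordinate_spans\<close>).  It remains to see which indices lie in some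
  admissible \<open>\<Lambda>\<close>: an index after \<open>\<gamma>\<close> outside the support can be added exactly when its block has
  room for one more nonzero entry (\<open>Inl_in_Union_admissible\<close>, \<open>Inr_in_Union_admissible\<close>).
  The four cases of the theorem are the four ways in which the two blocks can be full or not.
\<close>

section \<open>Coordinates and coordinate subspaces\<close>

lemma coord_simps [simp]:
  "coord z (Inl i) = fst z $ i" "coord z (Inr j) = snd z $ j"
  by (simp_all add: coord_def)

lemma coord_eqI: "(\<And>i. coord z i = coord w i) \<Longrightarrow> z = w"
  by (metis coord_simps prod_eq_iff vec_eq_iff)

lemma coord_add [simp]: "coord (z + w) i = coord z i + coord w i"
  by (cases i) auto

lemma coord_scaleR [simp]: "coord (c *\<^sub>R z) i = c * coord z i"
  by (cases i) auto

lemma coord_zero [simp]: "coord 0 i = 0"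
  by (cases i) auto

lemma coord_sum: "coord (sum f A) i = (\<Sum>a\<in>A. coord (f a) i)"
  by (induction A rule: infinite_finite_induct) auto

lemma coord_unit_vec: "coord (unit_vec k) i = (if i = k then 1 else 0)"
  by (cases i; cases k) (auto simp: unit_vec_def axis_def)

lemma inner_unit_vec: "d \<bullet> unit_vec i = coord d i"
  by (cases i; cases d) (auto simp: unit_vec_def inner_axis)

lemma coord_expansion: "d = (\<Sum>i\<in>UNIV. coord d i *\<^sub>R unit_vec i)"
  by (rule coord_eqI) (simp add: coord_sum coord_unit_vec if_distrib cong: if_cong)

lemma supp_subset_iff:
  "supp d \<subseteq> \<Lambda> \<longleftrightarrow> {i. fst d $ i \<noteq> 0} \<subseteq> Inl -` \<Lambda> \<and> {j. snd d $ j \<noteq> 0} \<subseteq> Inr -` \<Lambda>"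
  unfolding supp_def subset_iff by (auto simp: split_sum_all)

lemma mem_span_unit_vec_iff: "d \<in> span (unit_vec ` \<Lambda>) \<longleftrightarrow> supp d \<subseteq> \<Lambda>"
proof
  assume "d \<in> span (unit_vec ` \<Lambda>)"
  then show "supp d \<subseteq> \<Lambda>"
  proof (induction rule: span_induct_alt)
    case base
    then show ?case by (simp add: supp_def)
  next
    case (step c v w)
    then show ?case by (auto simp: supp_def coord_unit_vec split: if_splits)
  qed
next
  assume "supp d \<subseteq> \<Lambda>"
  then have "coord d i *\<^sub>R unit_vec i \<in> span (unit_vec ` \<Lambda>)" for i
    by (cases "coord d i = 0") (auto simp: supp_def intro!: span_scale[OF span_base] span_zero)
  then have "(\<Sum>i\<in>UNIV. coord d i *\<^sub>R unit_vec i) \<in> span (unit_vec ` \<Lambda>)"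
    by (intro span_sum)
  then show "d \<in> span (unit_vec ` \<Lambda>)"
    using coord_expansion[of d] by simp
qed

lemma less_eq_Inl_iff: "p \<le> (Inl g :: 'a::linorder + 'b::linorder) \<longleftrightarrow> (\<exists>i. p = Inl i \<and> i \<le> g)"
  by (cases p) (auto simp: less_eq_sum_def)

lemma Inl_less_simps [simp]:
  "(Inl g :: 'a::linorder + 'b::linorder) < Inl i \<longleftrightarrow> g < i"
  "(Inl g :: 'a::linorder + 'b::linorder) < Inr j"
  by (auto simp: less_sum_def less_eq_sum_def)

lemma card_Int_I1: "card (\<Lambda> \<inter> I1) = card (Inl -` \<Lambda>)"
proof -
  have "card (Inl ` (Inl -` \<Lambda>)) = card (Inl -` \<Lambda>)"
    by (simp add: card_image)
  moreover have "Inl ` (Inl -` \<Lambda>) = \<Lambda> \<inter> I1"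
    by (auto simp: I1_def)
  ultimately show ?thesis by metis
qed

lemma card_Int_I2: "card (\<Lambda> \<inter> I2) = card (Inr -` \<Lambda>)"
proof -
  have "card (Inr ` (Inr -` \<Lambda>)) = card (Inr -` \<Lambda>)"
    by (simp add: card_image)
  moreover have "Inr ` (Inr -` \<Lambda>) = \<Lambda> \<inter> I2"
    by (auto simp: I2_def)
  ultimately show ?thesis by metis
qed

lemma card_supp_I1: "card (supp (x, y) \<inter> I1) = l0 x"
  by (simp add: card_Int_I1 l0_def supp_def vimage_def)

lemma card_supp_I2: "card (supp (x, y) \<inter> I2) = l0 y"
  by (simp add: card_Int_I2 l0_def supp_def vimage_def)

lemma l0_le_card: "{i. x $ i \<noteq> 0} \<subseteq> A \<Longrightarrow> l0 x \<le> card A"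
  unfolding l0_def by (rule card_mono) auto

section \<open>Normalised sparse vectors\<close>

lemma first_nz_eqI:
  fixes x :: "real ^ 'k::{finite,linorder}"
  assumes "x $ g \<noteq> 0" and "\<And>j. j < g \<Longrightarrow> x $ j = 0"
  shows "first_nz x = g"
  unfolding first_nz_def using assms by (intro Min_eqI) (auto simp: not_less[symmetric])

lemma first_nz_less:
  fixes x :: "real ^ 'k::{finite,linorder}"
  assumes "j < first_nz x"
  shows "x $ j = 0"
  using assms Min_le[of "{i. x $ i \<noteq> 0}" j] by (fastforce simp: first_nz_def)

lemma F1_iff: "x \<in> F1 s \<longleftrightarrow> l0 x \<le> s \<and> x $ first_nz x = 1"
  by (auto simp: F1_def inner_axis')

lemma F1_I:
  fixes x :: "real ^ 'k::{finite,linorder}"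
  assumes "l0 x \<le> s" and "x $ g = 1" and "\<And>j. j < g \<Longrightarrow> x $ j = 0"
  shows "x \<in> F1 s"
  using assms first_nz_eqI[of x g] by (simp add: F1_iff)

text \<open>
  The position of the leading \<open>1\<close> is locally constant on \<open>F1 s\<close>: moving it would change the entry
  at the earlier of the two positions by \<open>1\<close>.
\<close>

lemma first_nz_eventually_const:
  fixes x :: "real ^ 'k::{finite,linorder}"
  assumes "x \<in> F1 s" and X: "\<And>k. X k \<in> F1 s" and lim: "X \<longlonglongrightarrow> x"
  shows "eventually (\<lambda>k. first_nz (X k) = first_nz x) sequentially"
proof -
  have "eventually (\<lambda>k. dist (X k) x < 1) sequentially"
    using lim by (simp add: tendstoD)
  then show ?thesis
  proof eventually_elim
    case (elim k)
    have near: "\<bar>X k $ i - x $ i\<bar> < 1" for i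
      using elim component_le_norm_cart[of "X k - x" i] by (simp add: dist_norm)
    show ?case
    proof (rule linorder_cases[of "first_nz (X k)" "first_nz x"])
      assume "first_nz (X k) < first_nz x"
      then show ?thesis
        using near[of "first_nz (X k)"] X[of k] first_nz_less[of _ x] by (simp add: F1_iff)
    next
      assume "first_nz x < first_nz (X k)"
      then show ?thesis
        using near[of "first_nz x"] \<open>x \<in> F1 s\<close> first_nz_less[of _ "X k"] by (simp add: F1_iff)
    qed
  qed
qed

section \<open>Tangent directions\<close>

lemma bouligand_tangent_line:
  assumes "\<And>\<mu>::real. x + \<mu> *\<^sub>R d \<in> S"
  shows "d \<in> bouligand_tangent S x"
proof -
  let ?X = "\<lambda>k. x + (1 / real (Suc k)) *\<^sub>R d" and ?c = "\<lambda>k. real (Suc k)"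
  have "(\<lambda>k. x + (1 / real (Suc k)) *\<^sub>R d) \<longlonglongrightarrow> x + 0 *\<^sub>R d"
    by (intro tendsto_intros LIMSEQ_Suc lim_1_over_n)
  then have "?X \<longlonglongrightarrow> x" by simp
  moreover have "(\<lambda>k. ?c k *\<^sub>R (?X k - x)) \<longlonglongrightarrow> d"
    by (simp del: of_nat_Suc)
  ultimately show ?thesis
    unfolding bouligand_tangent_def using assms
    by (intro CollectI exI[of _ ?X] exI[of _ ?c]) auto
qed

lemma bouligand_tangent_mono:
  assumes "A \<subseteq> B"
  shows "bouligand_tangent A x \<subseteq> bouligand_tangent B x"
  unfolding bouligand_tangent_def using assms by blast

lemma bouligand_tangent_Times:
  assumes "d \<in> bouligand_tangent (A \<times> B) (x, y)"
  shows "fst d \<in> bouligand_tangent A x" and "snd d \<in> bouligand_tangent B y"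
proof -
  obtain Z c where Z: "\<And>k. Z k \<in> A \<times> B" "Z \<longlonglongrightarrow> (x, y)" "\<And>k. c k \<ge> 0"
    and lim: "(\<lambda>k. c k *\<^sub>R (Z k - (x, y))) \<longlonglongrightarrow> d"
    using assms unfolding bouligand_tangent_def by auto
  have "fst (Z k) \<in> A" "snd (Z k) \<in> B" for k
    using Z(1)[of k] by auto
  moreover have "(\<lambda>k. fst (Z k)) \<longlonglongrightarrow> x" "(\<lambda>k. snd (Z k)) \<longlonglongrightarrow> y"
    using tendsto_fst[OF Z(2)] tendsto_snd[OF Z(2)] by auto
  moreover have "(\<lambda>k. c k *\<^sub>R (fst (Z k) - x)) \<longlonglongrightarrow> fst d"
      "(\<lambda>k. c k *\<^sub>R (snd (Z k) - y)) \<longlonglongrightarrow> snd d"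
    using tendsto_fst[OF lim] tendsto_snd[OF lim] by auto
  ultimately show "fst d \<in> bouligand_tangent A x" "snd d \<in> bouligand_tangent B y"
    unfolding bouligand_tangent_def using Z(3)
    by (auto intro!: exI[of _ "\<lambda>k. fst (Z k)"] exI[of _ "\<lambda>k. snd (Z k)"] exI[of _ c])
qed

text \<open>
  Nonzero entries of \<open>x\<close> stay nonzero by continuity.  Where \<open>x\<close> vanishes, a nonzero entry of the
  limit \<open>d\<close> is the limit of the entries of \<open>c k *\<^sub>R X k\<close>, which are then nonzero as well.
\<close>

lemma eventually_supports_subset:
  fixes x d :: "real ^ 'k::finite"
  assumes X: "X \<longlonglongrightarrow> x" and lim: "(\<lambda>k. c k *\<^sub>R (X k - x)) \<longlonglongrightarrow> d"
  shows "eventually (\<lambda>k. {i. x $ i \<noteq> 0 \<or> d $ i \<noteq> 0} \<subseteq> {i. X k $ i \<noteq> 0}) sequentially"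
proof -
  have "eventually (\<lambda>k. x $ i \<noteq> 0 \<or> d $ i \<noteq> 0 \<longrightarrow> X k $ i \<noteq> 0) sequentially" for i
  proof (cases "x $ i = 0")
    case False
    then show ?thesis
      using tendsto_imp_eventually_ne[OF tendsto_vec_nth[OF X, of i], of 0]
      by (auto elim: eventually_mono)
  next
    case True
    show ?thesis
    proof (cases "d $ i = 0")
      case False
      then have "eventually (\<lambda>k. (c k *\<^sub>R (X k - x)) $ i \<noteq> 0) sequentially"
        using tendsto_imp_eventually_ne[OF tendsto_vec_nth[OF lim, of i], of 0] by blast
      then show ?thesis
        by eventually_elim (use True in auto)
    qed (use True in simp)
  qed
  then have "eventually (\<lambda>k. \<forall>i. x $ i \<noteq> 0 \<or> d $ i \<noteq> 0 \<longrightarrow> X k $ i \<noteq> 0) sequentially"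
    by (rule eventually_all_finite)
  then show ?thesis
    by eventually_elim auto
qed

lemma tangent_F2_necessary:
  assumes "d \<in> bouligand_tangent (F2 t) y"
  shows "card {i. y $ i \<noteq> 0 \<or> d $ i \<noteq> 0} \<le> t"
proof -
  obtain Y c where Y: "\<And>k. Y k \<in> F2 t" "Y \<longlonglongrightarrow> y"
    and lim: "(\<lambda>k. c k *\<^sub>R (Y k - y)) \<longlonglongrightarrow> d"
    using assms unfolding bouligand_tangent_def by auto
  obtain k where "{i. y $ i \<noteq> 0 \<or> d $ i \<noteq> 0} \<subseteq> {i. Y k $ i \<noteq> 0}"
    using eventually_supports_subset[OF Y(2) lim] eventually_happens by force
  then have "card {i. y $ i \<noteq> 0 \<or> d $ i \<noteq> 0} \<le> l0 (Y k)"
    unfolding l0_def by (intro card_mono) auto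
  then show ?thesis
    using Y(1)[of k] by (simp add: F2_def)
qed

lemma tangent_F1_necessary:
  fixes x d :: "real ^ 'k::{finite,linorder}"
  assumes x: "x \<in> F1 s" and d: "d \<in> bouligand_tangent (F1 s) x"
  shows "card {i. x $ i \<noteq> 0 \<or> d $ i \<noteq> 0} \<le> s" and "\<And>j. j \<le> first_nz x \<Longrightarrow> d $ j = 0"
proof -
  obtain X c where X: "\<And>k. X k \<in> F1 s" "X \<longlonglongrightarrow> x"
    and lim: "(\<lambda>k. c k *\<^sub>R (X k - x)) \<longlonglongrightarrow> d"
    using d unfolding bouligand_tangent_def by auto
  \<comment> \<open>A larger set has a larger tangent cone, so the bound for sparse vectors applies.\<close>
  show "card {i. x $ i \<noteq> 0 \<or> d $ i \<noteq> 0} \<le> s"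
  proof (rule tangent_F2_necessary)
    have "bouligand_tangent (F1 s) x \<subseteq> bouligand_tangent (F2 s) x"
      by (rule bouligand_tangent_mono) (auto simp: F1_def F2_def)
    then show "d \<in> bouligand_tangent (F2 s) x"
      using d by blast
  qed
  show "d $ j = 0" if j: "j \<le> first_nz x" for j
  proof -
    have "eventually (\<lambda>k. (c k *\<^sub>R (X k - x)) $ j = 0) sequentially"
      using first_nz_eventually_const[OF x X]
    proof eventually_elim
      case (elim k)
      have "X k $ j = x $ j"
      proof (cases "j = first_nz x")
        case True
        then show ?thesis
          using elim x X(1)[of k] by (simp add: F1_iff)
      next
        case False
        then have "j < first_nz x" "j < first_nz (X k)"
          using j elim by auto
        then show ?thesis
          by (simp add: first_nz_less)
      qed
      then show ?case by simp
    qed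
    then have "(\<lambda>k. (c k *\<^sub>R (X k - x)) $ j) \<longlonglongrightarrow> 0"
      by (rule tendsto_eventually)
    then show ?thesis
      using tendsto_vec_nth[OF lim, of j] LIMSEQ_unique by blast
  qed
qed

section \<open>The tangent cone as a union of coordinate subspaces\<close>

definition admissible ::
  "nat \<Rightarrow> nat \<Rightarrow> (real ^ 'm::{finite,linorder}) \<Rightarrow> (real ^ 'n::{finite,linorder}) \<Rightarrow> ('m + 'n) set set"
where
  "admissible s t x y =
     {\<Lambda>. supp (x, y) - {Inl (first_nz x)} \<subseteq> \<Lambda> \<and>
          (\<forall>j. j \<le> Inl (first_nz x) \<longrightarrow> j \<notin> \<Lambda>) \<and>
          card (\<Lambda> \<inter> I1) \<le> s - 1 \<and> card (\<Lambda> \<inter> I2) \<le> t}"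

text \<open>
  The first block may hold one index fewer than \<open>s\<close> because the leading position is left out of
  it; putting that position back gives a set of at most \<open>s\<close> indices that contains the support of \<open>x\<close>.
\<close>

lemma admissible_iff:
  "\<Lambda> \<in> admissible s t x y \<longleftrightarrow>
     {i. x $ i \<noteq> 0} \<subseteq> insert (first_nz x) (Inl -` \<Lambda>) \<and> (\<forall>j\<le>first_nz x. Inl j \<notin> \<Lambda>) \<and>
     {j. y $ j \<noteq> 0} \<subseteq> Inr -` \<Lambda> \<and> card (Inl -` \<Lambda>) \<le> s - 1 \<and> card (Inr -` \<Lambda>) \<le> t"
proof -
  have "supp (x, y) - {Inl (first_nz x)} \<subseteq> \<Lambda> \<longleftrightarrow> supp (x, y) \<subseteq> insert (Inl (first_nz x)) \<Lambda>"
    by blast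
  also have "\<dots> \<longleftrightarrow>
      {i. x $ i \<noteq> 0} \<subseteq> insert (first_nz x) (Inl -` \<Lambda>) \<and> {j. y $ j \<noteq> 0} \<subseteq> Inr -` \<Lambda>"
    unfolding supp_subset_iff by auto
  finally show ?thesis
    unfolding admissible_def by (auto simp: less_eq_Inl_iff card_Int_I1 card_Int_I2)
qed

lemma line_in_F:
  assumes s: "0 < s" and x: "x \<in> F1 s" and \<Lambda>: "\<Lambda> \<in> admissible s t x y" and d: "supp d \<subseteq> \<Lambda>"
  shows "(x, y) + \<mu> *\<^sub>R d \<in> F s t"
proof -
  have d1: "fst d $ i = 0" if "Inl i \<notin> \<Lambda>" for i
    using d that by (force simp: supp_def)
  have d2: "snd d $ j = 0" if "Inr j \<notin> \<Lambda>" for j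
    using d that by (force simp: supp_def)
  note adm = \<Lambda>[unfolded admissible_iff]
  have "l0 (x + \<mu> *\<^sub>R fst d) \<le> card (insert (first_nz x) (Inl -` \<Lambda>))"
    by (rule l0_le_card) (use adm d1 in \<open>force\<close>)
  also have "\<dots> \<le> s"
    using adm s card_insert_le_m1[of s "Inl -` \<Lambda>" "first_nz x"] by auto
  finally have "x + \<mu> *\<^sub>R fst d \<in> F1 s"
    by (rule F1_I[where g = "first_nz x"]) (use x adm d1 in \<open>auto simp: F1_iff first_nz_less\<close>)
  moreover have "l0 (y + \<mu> *\<^sub>R snd d) \<le> card (Inr -` \<Lambda>)"
    by (rule l0_le_card) (use adm d2 in \<open>force\<close>)
  then have "y + \<mu> *\<^sub>R snd d \<in> F2 t"
    using adm by (simp add: F2_def)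
  ultimately show ?thesis
    by (cases d) (simp add: F_def)
qed

text \<open>
  For a tangent direction \<open>d\<close> an admissible index set is the union of the supports of \<open>d\<close> and of
  the base point without the leading position.
\<close>

lemma tangent_iff_admissible:
  assumes s: "0 < s" and z: "(x, y) \<in> F s t"
  shows "d \<in> bouligand_tangent (F s t) (x, y) \<longleftrightarrow> (\<exists>\<Lambda>\<in>admissible s t x y. supp d \<subseteq> \<Lambda>)"
proof
  have x: "x \<in> F1 s"
    using z by (simp add: F_def)
  {
    assume "\<exists>\<Lambda>\<in>admissible s t x y. supp d \<subseteq> \<Lambda>"
    then obtain \<Lambda> where "\<Lambda> \<in> admissible s t x y" "supp d \<subseteq> \<Lambda>"
      by blast
    then show "d \<in> bouligand_tangent (F s t) (x, y)"
      by (intro bouligand_tangent_line line_in_F[OF s x])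
  }
  assume "d \<in> bouligand_tangent (F s t) (x, y)"
  then have d: "fst d \<in> bouligand_tangent (F1 s) x" "snd d \<in> bouligand_tangent (F2 t) y"
    unfolding F_def by (rule bouligand_tangent_Times)+
  let ?g = "first_nz x"
  let ?A = "{i. x $ i \<noteq> 0 \<or> fst d $ i \<noteq> 0}"
  let ?\<Lambda> = "(supp (x, y) \<union> supp d) - {Inl ?g}"
  have zero: "fst d $ j = 0" if "j \<le> ?g" for j
    using tangent_F1_necessary(2)[OF x d(1) that] .
  have "Inl -` ?\<Lambda> = ?A - {?g}"
    by (auto simp: supp_def)
  moreover have "?g \<in> ?A"
    using x by (simp add: F1_iff)
  ultimately have "card (Inl -` ?\<Lambda>) \<le> s - 1"
    using tangent_F1_necessary(1)[OF x d(1)] by simp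
  moreover have "Inr -` ?\<Lambda> = {j. y $ j \<noteq> 0 \<or> snd d $ j \<noteq> 0}"
    by (auto simp: supp_def)
  then have "card (Inr -` ?\<Lambda>) \<le> t"
    using tangent_F2_necessary[OF d(2)] by simp
  moreover have "x $ j = 0" if "j \<le> ?g" "j \<noteq> ?g" for j
    using that by (simp add: first_nz_less)
  ultimately have "?\<Lambda> \<in> admissible s t x y"
    using zero unfolding admissible_iff by (auto simp: supp_def)
  moreover have "supp d \<subseteq> ?\<Lambda>"
    using zero[of ?g] by (auto simp: supp_def)
  ultimately show "\<exists>\<Lambda>\<in>admissible s t x y. supp d \<subseteq> \<Lambda>"
    by blast
qed

section \<open>The normal cone\<close>

text \<open>
  Each subspace contains \<open>unit_vec i\<close> together with its negative, so the inequality defining the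
  normal cone becomes an equation for every coordinate that occurs.
\<close>

lemma normal_of_coordinate_spans:
  assumes "bouligand_tangent S z = (\<Union>\<Lambda>\<in>\<A>. span (unit_vec ` \<Lambda>))"
  shows "bouligand_normal S z = {d. \<forall>i\<in>\<Union>\<A>. coord d i = 0}"
proof (intro set_eqI iffI)
  fix d
  assume d: "d \<in> bouligand_normal S z"
  have "coord d i = 0" if "\<Lambda> \<in> \<A>" "i \<in> \<Lambda>" for \<Lambda> i
  proof -
    have "unit_vec i \<in> span (unit_vec ` \<Lambda>)"
      using that by (simp add: span_base)
    then have "unit_vec i \<in> bouligand_tangent S z" "- unit_vec i \<in> bouligand_tangent S z"
      using that assms span_neg by blast+
    then have "d \<bullet> unit_vec i \<le> 0" "d \<bullet> (- unit_vec i) \<le> 0"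
      using d unfolding bouligand_normal_def by blast+
    then show ?thesis
      by (simp add: inner_unit_vec)
  qed
  then show "d \<in> {d. \<forall>i\<in>\<Union>\<A>. coord d i = 0}"
    by blast
next
  fix d
  assume d: "d \<in> {d. \<forall>i\<in>\<Union>\<A>. coord d i = 0}"
  have "d \<bullet> u = 0" if "\<Lambda> \<in> \<A>" "u \<in> span (unit_vec ` \<Lambda>)" for \<Lambda> u
    using that(2)
  proof (induction rule: span_induct_alt)
    case (step c v w)
    then show ?case
      using d that(1) by (auto simp: inner_add_right inner_unit_vec)
  qed simp
  then show "d \<in> bouligand_normal S z"
    unfolding bouligand_normal_def assms by auto
qed

text \<open>
  The support of the base point without the leading position is itself admissible, and it is the
  smallest admissible set.  Hence an index outside it lies in some admissible set exactly when it
  may be added to this smallest one.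
\<close>

lemma least_admissible:
  assumes z: "(x, y) \<in> F s t"
  shows "supp (x, y) - {Inl (first_nz x)} \<in> admissible s t x y"
proof -
  let ?\<Lambda> = "supp (x, y) - {Inl (first_nz x)}"
  have x: "x $ first_nz x = 1" "l0 x \<le> s" and y: "l0 y \<le> t"
    using z by (auto simp: F_def F1_iff F2_def)
  have "Inl -` ?\<Lambda> = {i. x $ i \<noteq> 0} - {first_nz x}" "Inr -` ?\<Lambda> = {j. y $ j \<noteq> 0}"
    by (auto simp: supp_def)
  then have "card (Inl -` ?\<Lambda>) \<le> s - 1" "card (Inr -` ?\<Lambda>) \<le> t"
    using x y by (simp_all add: l0_def)
  moreover have "Inl j \<notin> ?\<Lambda>" if "j \<le> first_nz x" for j
    using that first_nz_less[of j x] by (cases "j = first_nz x") (auto simp: supp_def)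
  ultimately show ?thesis
    unfolding admissible_iff by (auto simp: supp_def)
qed

lemma Inl_in_Union_admissible:
  assumes s: "0 < s" and z: "(x, y) \<in> F s t"
  shows "Inl i \<in> \<Union>(admissible s t x y) \<longleftrightarrow> first_nz x < i \<and> (x $ i \<noteq> 0 \<or> l0 x < s)"
proof
  have x: "x $ first_nz x = 1"
    using z by (simp add: F_def F1_iff)
  {
    assume "Inl i \<in> \<Union>(admissible s t x y)"
    then obtain \<Lambda> where \<Lambda>: "\<Lambda> \<in> admissible s t x y" "Inl i \<in> \<Lambda>"
      by blast
    note adm = \<Lambda>(1)[unfolded admissible_iff]
    have i: "first_nz x < i"
      using adm \<Lambda>(2) by (meson not_le)
    moreover have "l0 x < s" if "x $ i = 0"
    proof -
      have "l0 x \<le> card (insert (first_nz x) (Inl -` \<Lambda> - {i}))"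
        by (rule l0_le_card) (use adm that in auto)
      also have "\<dots> \<le> Suc (card (Inl -` \<Lambda> - {i}))"
        by (rule card_insert_le_m1) auto
      also have "\<dots> = card (Inl -` \<Lambda>)"
        using \<Lambda>(2) by (intro card_Suc_Diff1) auto
      also have "\<dots> < s"
        using adm s by linarith
      finally show ?thesis .
    qed
    ultimately show "first_nz x < i \<and> (x $ i \<noteq> 0 \<or> l0 x < s)"
      by blast
  }
  assume i: "first_nz x < i \<and> (x $ i \<noteq> 0 \<or> l0 x < s)"
  let ?\<Lambda>\<^sub>0 = "supp (x, y) - {Inl (first_nz x)}"
  have least: "?\<Lambda>\<^sub>0 \<in> admissible s t x y"
    using z by (rule least_admissible)
  show "Inl i \<in> \<Union>(admissible s t x y)"
  proof (cases "x $ i = 0")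
    case False
    then have "Inl i \<in> ?\<Lambda>\<^sub>0"
      using i by (auto simp: supp_def)
    then show ?thesis
      using least by blast
  next
    case True
    have "Inl -` insert (Inl i) ?\<Lambda>\<^sub>0 = insert i ({i. x $ i \<noteq> 0} - {first_nz x})"
      by (auto simp: supp_def)
    also have "card \<dots> = Suc (l0 x - 1)"
      using True x by (simp add: l0_def)
    also have "\<dots> \<le> s - 1"
    proof -
      have "l0 x > 0"
        using x by (auto simp: l0_def card_gt_0_iff intro: exI[of _ "first_nz x"])
      moreover have "l0 x < s"
        using i True by blast
      ultimately show ?thesis
        by linarith
    qed
    finally have "card (Inl -` insert (Inl i) ?\<Lambda>\<^sub>0) \<le> s - 1" .
    moreover have "Inr -` insert (Inl i) ?\<Lambda>\<^sub>0 = Inr -` ?\<Lambda>\<^sub>0"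
      by auto
    ultimately have "insert (Inl i) ?\<Lambda>\<^sub>0 \<in> admissible s t x y"
      using least i unfolding admissible_iff by auto
    then show ?thesis
      by blast
  qed
qed

lemma Inr_in_Union_admissible:
  assumes z: "(x, y) \<in> F s t"
  shows "Inr j \<in> \<Union>(admissible s t x y) \<longleftrightarrow> y $ j \<noteq> 0 \<or> l0 y < t"
proof
  {
    assume "Inr j \<in> \<Union>(admissible s t x y)"
    then obtain \<Lambda> where \<Lambda>: "\<Lambda> \<in> admissible s t x y" "Inr j \<in> \<Lambda>"
      by blast
    note adm = \<Lambda>(1)[unfolded admissible_iff]
    have "l0 y < t" if "y $ j = 0"
    proof -
      have "l0 y < card (Inr -` \<Lambda>)"
        unfolding l0_def by (rule psubset_card_mono) (use adm \<Lambda>(2) that in auto)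
      then show ?thesis
        using adm by linarith
    qed
    then show "y $ j \<noteq> 0 \<or> l0 y < t"
      by blast
  }
  assume j: "y $ j \<noteq> 0 \<or> l0 y < t"
  let ?\<Lambda>\<^sub>0 = "supp (x, y) - {Inl (first_nz x)}"
  have least: "?\<Lambda>\<^sub>0 \<in> admissible s t x y"
    using z by (rule least_admissible)
  show "Inr j \<in> \<Union>(admissible s t x y)"
  proof (cases "y $ j = 0")
    case False
    then have "Inr j \<in> ?\<Lambda>\<^sub>0"
      by (auto simp: supp_def)
    then show ?thesis
      using least by blast
  next
    case True
    have "Inr -` insert (Inr j) ?\<Lambda>\<^sub>0 = insert j {j. y $ j \<noteq> 0}"
      by (auto simp: supp_def)
    also have "card \<dots> = Suc (l0 y)"
      using True by (simp add: l0_def)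
    also have "\<dots> \<le> t"
      using j True by simp
    finally have "card (Inr -` insert (Inr j) ?\<Lambda>\<^sub>0) \<le> t" .
    moreover have "Inl -` insert (Inr j) ?\<Lambda>\<^sub>0 = Inl -` ?\<Lambda>\<^sub>0"
      by auto
    ultimately have "insert (Inr j) ?\<Lambda>\<^sub>0 \<in> admissible s t x y"
      using least unfolding admissible_iff by auto
    then show ?thesis
      by blast
  qed
qed

section \<open>Both cones\<close>

theorem theorem3p2:
  fixes x :: "real ^ 'm::{finite,linorder}"
    and y :: "real ^ 'n::{finite,linorder}"
    and s t :: nat
  assumes "0 < s" and "s < CARD('m)"
    and "0 < t" and "t < CARD('n)"
    and "(x, y) \<in> F s t"
  shows "bouligand_tangent (F s t) (x, y) =
           {d. l0 (fst d) \<le> s - 1 \<and> l0 (snd d) \<le> t \<and>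
               (\<forall>\<mu>::real. (x, y) + \<mu> *\<^sub>R d \<in> F s t) \<and>
               (\<forall>j. j \<le> Inl (first_nz x) \<longrightarrow> coord d j = 0)} \<and>
         bouligand_tangent (F s t) (x, y) =
           (\<Union>\<Lambda> \<in> {\<Lambda>. supp (x, y) - {Inl (first_nz x)} \<subseteq> \<Lambda> \<and>
                      (\<forall>j. j \<le> Inl (first_nz x) \<longrightarrow> j \<notin> \<Lambda>) \<and>
                      card (\<Lambda> \<inter> I1) \<le> s - 1 \<and> card (\<Lambda> \<inter> I2) \<le> t}.
              span (unit_vec ` \<Lambda>)) \<and>
         (card (supp (x, y) \<inter> I1) = s \<and> card (supp (x, y) \<inter> I2) = t \<longrightarrow>
           bouligand_normal (F s t) (x, y) =
             {d. \<forall>i \<in> supp (x, y) - {Inl (first_nz x)}. coord d i = 0}) \<and>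
         (card (supp (x, y) \<inter> I1) = s \<and> card (supp (x, y) \<inter> I2) < t \<longrightarrow>
           bouligand_normal (F s t) (x, y) =
             {d. \<forall>i \<in> ((supp (x, y) \<inter> I1) - {Inl (first_nz x)}) \<union> I2. coord d i = 0}) \<and>
         (card (supp (x, y) \<inter> I1) < s \<and> card (supp (x, y) \<inter> I2) = t \<longrightarrow>
           bouligand_normal (F s t) (x, y) =
             {d. \<forall>i \<in> {i \<in> I1. i > Inl (first_nz x)} \<union> (supp (x, y) \<inter> I2). coord d i = 0}) \<and>
         (card (supp (x, y) \<inter> I1) < s \<and> card (supp (x, y) \<inter> I2) < t \<longrightarrow>
           bouligand_normal (F s t) (x, y) =
             {d. \<forall>i. i > Inl (first_nz x) \<longrightarrow> coord d i = 0})"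
proof -
  let ?g = "first_nz x"
  let ?T = "bouligand_tangent (F s t) (x, y)"
  have s: "0 < s" and z: "(x, y) \<in> F s t"
    using assms by blast+
  have x: "x \<in> F1 s"
    using z by (simp add: F_def)
  have spans: "?T = (\<Union>\<Lambda>\<in>admissible s t x y. span (unit_vec ` \<Lambda>))"
    by (rule set_eqI) (simp only: tangent_iff_admissible[OF s z] mem_span_unit_vec_iff UN_iff)
  have lines: "?T = {d. l0 (fst d) \<le> s - 1 \<and> l0 (snd d) \<le> t \<and>
      (\<forall>\<mu>::real. (x, y) + \<mu> *\<^sub>R d \<in> F s t) \<and> (\<forall>j. j \<le> Inl ?g \<longrightarrow> coord d j = 0)}" (is "_ = ?R")
  proof (intro equalityI subsetI)
    show "d \<in> ?T" if "d \<in> ?R" for d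
      using that by (intro bouligand_tangent_line) blast
    show "d \<in> ?R" if d: "d \<in> ?T" for d
    proof -
      obtain \<Lambda> where \<Lambda>: "\<Lambda> \<in> admissible s t x y" "supp d \<subseteq> \<Lambda>"
        using d tangent_iff_admissible[OF s z] by blast
      have "l0 (fst d) \<le> card (Inl -` \<Lambda>)" "l0 (snd d) \<le> card (Inr -` \<Lambda>)"
        using \<Lambda>(2) unfolding supp_subset_iff by (auto intro: l0_le_card)
      then have "l0 (fst d) \<le> s - 1" "l0 (snd d) \<le> t"
        using \<Lambda>(1) unfolding admissible_iff by linarith+
      moreover have "\<forall>j. j \<le> Inl ?g \<longrightarrow> coord d j = 0"
        using \<Lambda> unfolding admissible_def supp_def by blast
      ultimately show ?thesis
        using line_in_F[OF s x \<Lambda>] by blast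
    qed
  qed
  \<comment> \<open>Each of the four index sets is compared with the union of the admissible sets blockwise.\<close>
  have normal: "bouligand_normal (F s t) (x, y) = {d. \<forall>i\<in>J. coord d i = 0}"
    if "\<And>i. Inl i \<in> J \<longleftrightarrow> ?g < i \<and> (x $ i \<noteq> 0 \<or> l0 x < s)"
      and "\<And>j. Inr j \<in> J \<longleftrightarrow> y $ j \<noteq> 0 \<or> l0 y < t" for J :: "('m + 'n) set"
  proof -
    have "p \<in> \<Union>(admissible s t x y) \<longleftrightarrow> p \<in> J" for p
      by (cases p)
        (simp_all only: Inl_in_Union_admissible[OF s z] Inr_in_Union_admissible[OF z] that)
    then have "\<Union>(admissible s t x y) = J"
      by blast
    then show ?thesis
      using normal_of_coordinate_spans[OF spans] by simp
  qed
  have supp_less: "i = ?g \<longleftrightarrow> \<not> ?g < i" if "x $ i \<noteq> 0" for i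
    using first_nz_less[of i x] that by force
  show ?thesis
  proof (intro conjI impI)
    show "?T = (\<Union>\<Lambda> \<in> {\<Lambda>. supp (x, y) - {Inl ?g} \<subseteq> \<Lambda> \<and>
                      (\<forall>j. j \<le> Inl ?g \<longrightarrow> j \<notin> \<Lambda>) \<and>
                      card (\<Lambda> \<inter> I1) \<le> s - 1 \<and> card (\<Lambda> \<inter> I2) \<le> t}.
              span (unit_vec ` \<Lambda>))"
      using spans unfolding admissible_def .
  next
    assume "card (supp (x, y) \<inter> I1) = s \<and> card (supp (x, y) \<inter> I2) = t"
    then have "l0 x = s" "l0 y = t"
      by (simp_all only: card_supp_I1 card_supp_I2)
    then show "bouligand_normal (F s t) (x, y) =
        {d. \<forall>i \<in> supp (x, y) - {Inl ?g}. coord d i = 0}"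
      by (intro normal) (use supp_less in \<open>auto simp: supp_def\<close>)
  next
    assume "card (supp (x, y) \<inter> I1) = s \<and> card (supp (x, y) \<inter> I2) < t"
    then have "l0 x = s" "l0 y < t"
      by (simp_all only: card_supp_I1 card_supp_I2)
    then show "bouligand_normal (F s t) (x, y) =
        {d. \<forall>i \<in> ((supp (x, y) \<inter> I1) - {Inl ?g}) \<union> I2. coord d i = 0}"
      by (intro normal) (use supp_less in \<open>auto simp: supp_def I1_def I2_def\<close>)
  next
    assume "card (supp (x, y) \<inter> I1) < s \<and> card (supp (x, y) \<inter> I2) = t"
    then have "l0 x < s" "l0 y = t"
      by (simp_all only: card_supp_I1 card_supp_I2)
    then show "bouligand_normal (F s t) (x, y) =
        {d. \<forall>i \<in> {i \<in> I1. i > Inl ?g} \<union> (supp (x, y) \<inter> I2). coord d i = 0}"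
      by (intro normal) (auto simp: supp_def I1_def I2_def)
  next
    assume "card (supp (x, y) \<inter> I1) < s \<and> card (supp (x, y) \<inter> I2) < t"
    then have "l0 x < s" "l0 y < t"
      by (simp_all only: card_supp_I1 card_supp_I2)
    then have "bouligand_normal (F s t) (x, y) = {d. \<forall>i \<in> {i. i > Inl ?g}. coord d i = 0}"
      by (intro normal) auto
    then show "bouligand_normal (F s t) (x, y) = {d. \<forall>i. i > Inl ?g \<longrightarrow> coord d i = 0}"
      by simp
  qed (fact lines)
qed

end
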